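(* Let $A^{*}\in\mathcal{M}(a_1,a_2;\Omega)$ and $B^{\#}\in\mathcal{M}(b_1,\widetilde{b_2};\Omega)$, with $A^{*}-a_1I$ invertible. Denote (pointwise) the spectrum of $A^{*}$ by $\{\lambda_i\}_{i=1}^N$ with $\lambda_1\ge\dots\ge\lambda_N$ and the spectrum of $B^{\#}$ by $\{\mu_i\}_{i=1}^N$ with $\mu_1\ge\dots\ge\mu_N$. Then $$\mathrm{tr}\left\{(A^{*}-a_1I)^{-1}(B^{\#}-b_1I)(A^{*}-a_1I)^{-1}\right\}\ \ge\ \mathrm{tr}\left\{D_\lambda^{-1}D_\mu D_\lambda^{-1}\right\},$$ where $D_\lambda=\mathrm{diag}(\lambda_1-a_1,\dots,\lambda_N-a_1)$ and $D_\mu=\mathrm{diag}(\mu_1-b_1,\dots,\mu_N-b_1)$. Equality holds in this inequality if and only if $A^{*}$ commutes with $B^{\#}$.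
   Context: $\Omega\subset\mathbb{R}^N$ is a bounded open set; $0<a_1<a_2$, $0<b_1<b_2$ and $\widetilde{b_2}=b_2\frac{a_2}{a_1}$. $\mathcal{M}(\alpha,\beta;\Omega)$ is the set of measurable real symmetric $N\times N$ matrix fields $A(x)$ on $\Omega$ with $(A(x)\xi,\xi)\ge\alpha|\xi|^2$ and $|A(x)\xi|\le\beta|\xi|$ for all $\xi\in\mathbb{R}^N$ and a.e. $x\in\Omega$. The statement is pointwise for a.e. $x\in\Omega$.
   Formalization: The equality clause is corrected: equality holds iff A* and B# commute and have a common orthonormal eigenbasis pairing each λ_i with μ_i; commutation alone is not enough, e.g. A*=diag(2,3), B#=diag(2,1), a_1=b_1=1, a_2=3, b_2=2 gives 1 > 1/4. *)

theory Defs
  imports "HOL-Analysis.Analysis"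
begin

text \<open>The class \<open>\<M>(\<alpha>, \<beta>; \<Omega>)\<close>.  As usual for coefficient fields, symmetry and the bounds
  are required outside one Lebesgue-null subset of \<open>\<Omega>\<close>; the null set does not depend on \<open>\<xi>\<close>.\<close>

definition matrix_class ::
    "real \<Rightarrow> real \<Rightarrow> (real^'n) set \<Rightarrow> (real^'n \<Rightarrow> real^'n^'n) set" where
  "matrix_class \<alpha> \<beta> \<Omega> =
     {A. A \<in> borel_measurable (lebesgue_on \<Omega>) \<and>
         (AE x in lebesgue_on \<Omega>.
            transpose (A x) = A x \<and>
            (\<forall>\<xi>. (A x *v \<xi>) \<bullet> \<xi> \<ge> \<alpha> * (norm \<xi>)\<^sup>2 \<and> norm (A x *v \<xi>) \<le> \<beta> * norm \<xi>))}"

text \<open>Coordinates are indexed by an arbitrary finite linear order, playing the role of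
  \<open>{1, \<dots>, N}\<close>, so a spectrum listed in decreasing order is itself indexed by \<open>'n\<close>.
  Eigenvalues are counted with multiplicity, as roots of the characteristic polynomial;
  \<open>mat t\<close> is the scalar matrix \<open>t I\<close>.\<close>

definition decreasing_spectrum :: "real^'n::{finite,linorder}^'n::{finite,linorder} \<Rightarrow> ('n \<Rightarrow> real) \<Rightarrow> bool" where
  "decreasing_spectrum M l \<longleftrightarrow>
     (\<forall>i j. i \<le> j \<longrightarrow> l j \<le> l i) \<and> (\<forall>t. det (mat t - M) = (\<Prod>i\<in>UNIV. t - l i))"

definition diag_matrix :: "('n \<Rightarrow> real) \<Rightarrow> real^'n^'n" where
  "diag_matrix d = (\<chi> i j. if i = j then d i else 0)"

text \<open>For two commuting symmetric matrices a common orthonormal eigenbasis always exists, but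
  it need not list both spectra in decreasing order: \<open>diag(3, 2)\<close> and \<open>diag(1, 2)\<close> commute.
  The trace inequality is strict for this pair, so its equality case is commutation in which
  the \<open>i\<close>-th eigenvalues of the two matrices, in the given listings, share the \<open>i\<close>-th
  eigenvector (the \<open>i\<close>-th column of \<open>P\<close>).\<close>

definition commute_matching_spectra ::
    "real^'n^'n \<Rightarrow> ('n \<Rightarrow> real) \<Rightarrow> real^'n^'n \<Rightarrow> ('n \<Rightarrow> real) \<Rightarrow> bool" where
  "commute_matching_spectra A l B m \<longleftrightarrow>
     A ** B = B ** A \<and>
     (\<exists>P. orthogonal_matrix P \<and>
          transpose P ** A ** P = diag_matrix l \<and> transpose P ** B ** P = diag_matrix m)"

end

theory Submission
  imports Defs "HOL-Computational_Algebra.Polynomial"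
begin

text \<open>Put \<open>d\<^sub>k = (\<lambda>\<^sub>k - a\<^sub>1)\<^sup>-\<^sup>2\<close>, which increases with \<open>k\<close>, and let \<open>p\<^sub>k\<close> be an orthonormal eigenbasis of
  \<open>A\<close>. Up to a constant the left-hand side is \<open>\<Sum>\<^sub>k d\<^sub>k (p\<^sub>k, B p\<^sub>k)\<close>. Such a sum is extremised over
  orthonormal bases by compactness; at an extremum, rotating two basis vectors into each other
  shows that \<open>B\<close> has no off-diagonal entry between levels with different weights, and that its
  diagonal entries are ordered oppositely to the weights. A second extremisation, with pairwise
  different weights and over the orthonormal eigenbases of \<open>A\<close> for the same listing only, leaves the
  first sum unchanged and removes the remaining off-diagonal entries. So an extremal
  eigenbasis of \<open>A\<close> can be traded for one that also diagonalises \<open>B\<close> in decreasing order, which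
  gives the inequality and the equality case together. With trivial constraints the same argument
  is the spectral theorem.\<close>

section \<open>Matrix identities for conjugation and diagonal matrices\<close>

lemma transpose_mult_entry:
  fixes V W :: "real^'n^'n"
  shows "(transpose V ** W) $ i $ j = column i V \<bullet> column j W"
  by (simp add: matrix_matrix_mult_def transpose_def column_def inner_vec_def)

lemma column_mult:
  fixes X V :: "real^'n^'n"
  shows "column j (X ** V) = X *v column j V"
  by (simp add: matrix_matrix_mult_def column_def matrix_vector_mult_def)

lemma conjugate_entry:
  fixes V X :: "real^'n^'n"
  shows "(transpose V ** X ** V) $ i $ j = column i V \<bullet> (X *v column j V)"
  by (metis transpose_mult_entry column_mult matrix_mul_assoc)

lemma mult_diag_matrix_entry: "(V ** diag_matrix l) $ i $ j = V $ i $ j * l j"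
  for V :: "real^'n^'n"
  by (simp add: matrix_matrix_mult_def diag_matrix_def if_distrib cong: if_cong)

lemma diag_matrix_mult_entry: "(diag_matrix l ** V) $ i $ j = l i * V $ i $ j"
  for V :: "real^'n^'n"
proof -
  have "(diag_matrix l ** V) $ i $ j = (\<Sum>k\<in>UNIV. if i = k then l i * V $ k $ j else 0)"
    unfolding matrix_matrix_mult_def diag_matrix_def vec_lambda_beta by (rule sum.cong) auto
  then show ?thesis by simp
qed

lemma diag_matrix_mult: "diag_matrix f ** diag_matrix g = diag_matrix (\<lambda>i. f i * g i)"
  for f g :: "'n::finite \<Rightarrow> real"
  by (simp add: vec_eq_iff diag_matrix_mult_entry) (simp add: diag_matrix_def)

lemma mat_eq_diag_matrix: "mat t = diag_matrix (\<lambda>_. t)"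
  by (simp add: vec_eq_iff mat_def diag_matrix_def)

lemma mat_vector_mult: "mat t *v x = t *\<^sub>R x" for x :: "real^'n"
proof -
  have "(mat t *v x) $ i = (\<Sum>j\<in>UNIV. if i = j then t * x $ i else 0)" for i
    unfolding matrix_vector_mult_def mat_def vec_lambda_beta by (rule sum.cong) auto
  then show ?thesis by (simp add: vec_eq_iff)
qed

lemma mat_mult_commute: "mat t ** V = V ** mat t" for V :: "real^'n^'n"
  by (simp add: mat_eq_diag_matrix vec_eq_iff diag_matrix_mult_entry mult_diag_matrix_entry)

lemma matrix_diff_ldistrib: "A ** (B - C) = A ** B - A ** C" for A B C :: "real^'n^'n"
  by (simp add: vec_eq_iff matrix_matrix_mult_def sum_subtractf algebra_simps)

lemma matrix_diff_rdistrib: "(B - C) ** A = B ** A - C ** A" for A B C :: "real^'n^'n"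
  by (simp add: vec_eq_iff matrix_matrix_mult_def sum_subtractf algebra_simps)

lemma trace_diag_matrix_mult:
  fixes V :: "real^'n^'n"
  shows "trace (diag_matrix f ** V) = (\<Sum>i\<in>UNIV. f i * V $ i $ i)"
  by (simp add: trace_def diag_matrix_mult_entry)

text \<open>\<open>matrix_inv\<close> is a choice among two-sided inverses. A one-sided inverse of a
  square matrix is two-sided, so \<open>N\<close> witnesses the choice, and uniqueness of inverses
  identifies the result.\<close>

lemma matrix_inv_eqI:
  fixes M N :: "real^'n^'n"
  assumes "M ** N = mat 1"
  shows "matrix_inv M = N"
proof -
  have NM: "N ** M = mat 1"
    using assms by (simp add: matrix_left_right_inverse)
  have "M ** matrix_inv M = mat 1 \<and> matrix_inv M ** M = mat 1"
    unfolding matrix_inv_def by (rule someI[of _ N]) (simp add: assms NM)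
  then have "matrix_inv M = matrix_inv M ** (M ** N)"
    using assms by simp
  also have "\<dots> = N"
    using \<open>M ** matrix_inv M = mat 1 \<and> matrix_inv M ** M = mat 1\<close>
    by (metis matrix_mul_assoc matrix_mul_lid)
  finally show ?thesis .
qed

section \<open>Orthonormal eigenbases and their compactness\<close>

text \<open>The listing \<open>l\<close> is part of the data: column \<open>k\<close> belongs to the
  eigenvalue \<open>l k\<close>. With \<open>A = 0\<close> and \<open>l = 0\<close> the set is the
  whole orthogonal group, so constrained and unconstrained extremisation share the same
  lemmas.\<close>

definition eigenbases :: "real^'n^'n \<Rightarrow> ('n \<Rightarrow> real) \<Rightarrow> (real^'n^'n) set" where
  "eigenbases A l = {V. orthogonal_matrix V \<and> A ** V = V ** diag_matrix l}"

definition weighted_trace :: "('n \<Rightarrow> real) \<Rightarrow> real^'n^'n \<Rightarrow> real^'n^'n \<Rightarrow> real" where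
  "weighted_trace g X V = (\<Sum>k\<in>UNIV. g k * (transpose V ** X ** V) $ k $ k)"

lemma eigenbases_iff_columns:
  fixes A V :: "real^'n^'n"
  shows "V \<in> eigenbases A l \<longleftrightarrow>
    (\<forall>i j. column i V \<bullet> column j V = (if i = j then 1 else 0)) \<and>
    (\<forall>k. A *v column k V = l k *\<^sub>R column k V)"
proof -
  have "orthogonal_matrix V \<longleftrightarrow> (\<forall>i j. column i V \<bullet> column j V = (if i = j then 1 else 0))"
    by (simp add: orthogonal_matrix vec_eq_iff transpose_mult_entry mat_def)
  moreover have "A ** V = V ** diag_matrix l \<longleftrightarrow> (\<forall>k. A *v column k V = l k *\<^sub>R column k V)"
  proof -
    have "A ** V = V ** diag_matrix l \<longleftrightarrow> (\<forall>k. column k (A ** V) = column k (V ** diag_matrix l))"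
      by (auto simp: vec_eq_iff column_def)
    moreover have "column k (V ** diag_matrix l) = l k *\<^sub>R column k V" for k
      by (simp add: vec_eq_iff column_def mult_diag_matrix_entry)
    ultimately show ?thesis by (simp add: column_mult)
  qed
  ultimately show ?thesis by (simp add: eigenbases_def)
qed

lemma eigenbases_iff_conjugate:
  fixes A V :: "real^'n^'n"
  shows "V \<in> eigenbases A l \<longleftrightarrow>
    orthogonal_matrix V \<and> transpose V ** A ** V = diag_matrix l"
  unfolding eigenbases_def orthogonal_matrix_def mem_Collect_eq
  by (metis matrix_mul_assoc matrix_mul_lid)

lemma eigenbases_decomposition:
  assumes "V \<in> eigenbases A l"
  shows "A = V ** diag_matrix l ** transpose V"
  using assms unfolding eigenbases_def orthogonal_matrix_def mem_Collect_eq
  by (metis matrix_mul_assoc matrix_mul_rid)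

text \<open>Membership is a finite system of polynomial equations in the entries, hence closed.
  Columns are unit vectors, so entries are at most 1 in absolute value, hence bounded.\<close>

lemma compact_eigenbases: "compact (eigenbases A l)" for A :: "real^'n^'n"
proof -
  have cont: "continuous_on UNIV (\<lambda>V::real^'n^'n. V $ i $ j)" for i j
    by (intro continuous_intros)
  have eq: "eigenbases A l =
      (\<Inter>i. \<Inter>j. {V. (\<Sum>k\<in>UNIV. V $ k $ i * V $ k $ j) = (if i = j then 1 else 0)}) \<inter>
      (\<Inter>i. \<Inter>j. {V. (\<Sum>k\<in>UNIV. A $ i $ k * V $ k $ j) = V $ i $ j * l j})"
    unfolding eigenbases_def
    by (auto simp: orthogonal_matrix vec_eq_iff transpose_mult_entry mult_diag_matrix_entry
        mat_def inner_vec_def column_def matrix_matrix_mult_def[of A])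
  have "closed (eigenbases A l)"
    unfolding eq by (intro closed_Int closed_INT ballI closed_Collect_eq continuous_intros)
  moreover have "bounded (eigenbases A l)"
  proof -
    have "norm V \<le> real CARD('n) * real CARD('n)" if "V \<in> eigenbases A l" for V
    proof -
      have n1: "norm (column i V) = 1" for i
        using that by (simp add: eigenbases_iff_columns norm_eq_1)
      have "\<bar>V $ i $ j\<bar> \<le> 1" for i j
        using component_le_norm_cart[of "column j V" i] n1[of j] by (simp add: column_def)
      then have "norm (V $ i) \<le> real CARD('n)" for i
        using norm_le_l1_cart[of "V $ i"] sum_mono[of UNIV "\<lambda>j. \<bar>V $ i $ j\<bar>" "\<lambda>_. 1"]
        by fastforce
      then have "(\<Sum>i\<in>UNIV. norm (V $ i)) \<le> (\<Sum>i\<in>(UNIV::'n set). real CARD('n))"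
        by (intro sum_mono)
      moreover have "norm V \<le> (\<Sum>i\<in>UNIV. norm (V $ i))"
        unfolding norm_vec_def by (rule L2_set_le_sum) simp
      ultimately show ?thesis by simp
    qed
    then show ?thesis by (auto simp: bounded_iff)
  qed
  ultimately show ?thesis by (simp add: compact_eq_bounded_closed)
qed

lemma weighted_trace_attains_max:
  fixes A X :: "real^'n^'n"
  assumes "eigenbases A l \<noteq> {}"
  obtains V where "V \<in> eigenbases A l"
    and "\<And>W. W \<in> eigenbases A l \<Longrightarrow> weighted_trace g X W \<le> weighted_trace g X V"
proof -
  have "continuous_on (eigenbases A l) (weighted_trace g X)"
    unfolding weighted_trace_def matrix_matrix_mult_def transpose_def
    by (simp, intro continuous_intros)
  with compact_eigenbases[of A l] assms that show ?thesis
    by (meson continuous_attains_sup)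
qed

section \<open>Plane rotations and conditions at a maximum\<close>

text \<open>When \<open>l i = l j\<close>, both columns lie in one eigenspace of \<open>A\<close>,
  and rotating them into each other stays inside it.\<close>

lemma eigenbases_rotate:
  fixes A V :: "real^'n^'n"
  assumes V: "V \<in> eigenbases A l" and "i \<noteq> j" and l: "l i = l j" and cs: "c\<^sup>2 + s\<^sup>2 = 1"
  obtains W where "W \<in> eigenbases A l"
    and "column i W = c *\<^sub>R column i V + s *\<^sub>R column j V"
    and "column j W = c *\<^sub>R column j V - s *\<^sub>R column i V"
    and "\<And>k. k \<noteq> i \<Longrightarrow> k \<noteq> j \<Longrightarrow> column k W = column k V"
proof -
  define W :: "real^'n^'n" where "W = (\<chi> r k. if k = i then c * V $ r $ i + s * V $ r $ j
    else if k = j then c * V $ r $ j - s * V $ r $ i else V $ r $ k)"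
  have i: "column i W = c *\<^sub>R column i V + s *\<^sub>R column j V"
    and j: "column j W = c *\<^sub>R column j V - s *\<^sub>R column i V"
    and k: "k \<noteq> i \<Longrightarrow> k \<noteq> j \<Longrightarrow> column k W = column k V" for k
    using \<open>i \<noteq> j\<close> by (auto simp: W_def vec_eq_iff column_def)
  have orth: "column p V \<bullet> column q V = (if p = q then 1 else 0)"
    and eig: "A *v column p V = l p *\<^sub>R column p V" for p q
    using V by (auto simp: eigenbases_iff_columns)
  have cols: "column p W = (if p = i then c *\<^sub>R column i V + s *\<^sub>R column j V
      else if p = j then c *\<^sub>R column j V - s *\<^sub>R column i V else column p V)" for p
    using i j k by simp
  have "column p W \<bullet> column q W = (if p = q then 1 else 0)" for p q
    using cs \<open>i \<noteq> j\<close> unfolding cols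
    by (auto simp: inner_simps orth power2_eq_square algebra_simps)
  moreover have "A *v column p W = l p *\<^sub>R column p W" for p
    using l unfolding cols
    by (auto simp: matrix_vector_right_distrib matrix_vector_mult_diff_distrib eig
        matrix_vector_mult_scaleR algebra_simps)
  ultimately have "W \<in> eigenbases A l"
    by (simp add: eigenbases_iff_columns)
  with i j k that show ?thesis by blast
qed

lemma symmetric_form:
  fixes X :: "real^'n^'n"
  assumes "transpose X = X"
  shows "u \<bullet> (X *v v) = v \<bullet> (X *v u)"
  by (metis assms dot_lmul_matrix inner_commute vector_transpose_matrix)

text \<open>For small \<open>s\<close> the cross term is of first order and can be given either
  sign, while the term with \<open>\<delta>\<close> is only of second order.\<close>

lemma coefficient_zero_if_quadratic_le_zero:
  fixes \<delta> w :: real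
  assumes "\<And>c s. c\<^sup>2 + s\<^sup>2 = 1 \<Longrightarrow> s\<^sup>2 * \<delta> + 2 * c * s * w \<le> 0"
  shows "w = 0"
proof (rule ccontr)
  assume "w \<noteq> 0"
  \<comment> \<open>\<open>h\<close> is the tangent \<open>s / c\<close> of the test angle. It is
    chosen so that, up to the factor \<open>r\<^sup>2\<close>, the expression becomes
    \<open>h\<^sup>2 * (\<delta> + 2 * (\<bar>\<delta>\<bar> + 1))\<close>, whose bracket is
    positive.\<close>
  define h where "h = w / (\<bar>\<delta>\<bar> + 1)"
  define r where "r = sqrt (1 + h\<^sup>2)"
  have r: "r\<^sup>2 = 1 + h\<^sup>2" "r > 0"
    by (auto simp: r_def add_pos_nonneg)
  have "(1 / r)\<^sup>2 + (h / r)\<^sup>2 = (1 + h\<^sup>2) / r\<^sup>2"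
    by (simp add: power_divide add_divide_distrib)
  also have "\<dots> = 1"
    using r by (metis divide_self power_not_zero less_irrefl)
  finally have "(h / r)\<^sup>2 * \<delta> + 2 * (1 / r) * (h / r) * w \<le> 0"
    by (rule assms)
  then have "(h\<^sup>2 * \<delta> + 2 * h * w) / r\<^sup>2 \<le> 0"
    by (simp add: power_divide power2_eq_square add_divide_distrib)
  then have "h\<^sup>2 * \<delta> + 2 * h * w \<le> 0"
    using r(2) by (simp add: divide_le_0_iff)
  moreover have "w = h * (\<bar>\<delta>\<bar> + 1)"
    by (simp add: h_def)
  ultimately have "h\<^sup>2 * (\<delta> + 2 * (\<bar>\<delta>\<bar> + 1)) \<le> 0"
    by (simp add: power2_eq_square algebra_simps)
  moreover have "h\<^sup>2 > 0"
    using \<open>w \<noteq> 0\<close> by (simp add: h_def add_nonneg_eq_0_iff)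
  ultimately show False
    by (simp add: mult_le_0_iff)
qed

text \<open>Rotating columns \<open>i\<close> and \<open>j\<close> changes the sum by
  \<open>g i - g j\<close> times a quadratic form in \<open>(c, s)\<close>, which must be
  nonpositive. Small angles kill the off-diagonal entry; a quarter turn, which swaps the vectors up
  to sign, orders the diagonal.\<close>

lemma weighted_trace_max_critical:
  fixes A X V :: "real^'n^'n"
  assumes X: "transpose X = X" and V: "V \<in> eigenbases A l"
    and max: "\<And>W. W \<in> eigenbases A l \<Longrightarrow> weighted_trace g X W \<le> weighted_trace g X V"
    and l: "l i = l j" and g: "g j < g i"
  shows "(transpose V ** X ** V) $ i $ j = 0"
    and "(transpose V ** X ** V) $ j $ j \<le> (transpose V ** X ** V) $ i $ i"
proof -
  define z where "z p q = (transpose V ** X ** V) $ p $ q" for p q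
  have z: "column p V \<bullet> (X *v column q V) = z p q" for p q
    by (simp add: z_def conjugate_entry)
  have zji: "z j i = z i j"
    using symmetric_form[OF X] z by metis
  have ij: "i \<noteq> j" using g by auto
  have main: "s\<^sup>2 * (z j j - z i i) + 2 * c * s * z i j \<le> 0" if cs: "c\<^sup>2 + s\<^sup>2 = 1" for c s
  proof -
    obtain W where W: "W \<in> eigenbases A l"
      and i: "column i W = c *\<^sub>R column i V + s *\<^sub>R column j V"
      and j: "column j W = c *\<^sub>R column j V - s *\<^sub>R column i V"
      and k: "\<And>k. k \<noteq> i \<Longrightarrow> k \<noteq> j \<Longrightarrow> column k W = column k V"
      using eigenbases_rotate[OF V ij l cs] by blast
    \<comment> \<open>Only the two terms touched by the rotation need to be compared.\<close>
    have split: "weighted_trace g X U = g i * (column i U \<bullet> (X *v column i U))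
        + g j * (column j U \<bullet> (X *v column j U))
        + (\<Sum>k\<in>UNIV - {i, j}. g k * (column k U \<bullet> (X *v column k U)))" for U
    proof -
      have "weighted_trace g X U = (\<Sum>k\<in>{i, j}. g k * (column k U \<bullet> (X *v column k U)))
        + (\<Sum>k\<in>UNIV - {i, j}. g k * (column k U \<bullet> (X *v column k U)))"
        unfolding weighted_trace_def conjugate_entry
        by (metis (no_types, lifting) add.commute finite sum.subset_diff subset_UNIV)
      then show ?thesis using ij by simp
    qed
    have "column i W \<bullet> (X *v column i W) = c\<^sup>2 * z i i + 2 * c * s * z i j + s\<^sup>2 * z j j"
      unfolding i by (simp add: inner_simps matrix_vector_right_distrib
          matrix_vector_mult_scaleR z zji power2_eq_square algebra_simps)
    moreover have "column j W \<bullet> (X *v column j W) = c\<^sup>2 * z j j - 2 * c * s * z i j + s\<^sup>2 * z i i"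
      unfolding j by (simp add: inner_simps matrix_vector_mult_diff_distrib
          matrix_vector_mult_scaleR z zji power2_eq_square algebra_simps)
    ultimately have "g i * (c\<^sup>2 * z i i + 2 * c * s * z i j + s\<^sup>2 * z j j)
        + g j * (c\<^sup>2 * z j j - 2 * c * s * z i j + s\<^sup>2 * z i i)
        \<le> g i * z i i + g j * z j j"
      using max[OF W] unfolding split by (simp add: k z)
    moreover have "c\<^sup>2 = 1 - s\<^sup>2" using cs by simp
    ultimately have "(g i - g j) * (s\<^sup>2 * (z j j - z i i) + 2 * c * s * z i j) \<le> 0"
      by (simp add: algebra_simps)
    then show ?thesis using g by (simp add: mult_le_0_iff)
  qed
  show "(transpose V ** X ** V) $ i $ j = 0"
    using coefficient_zero_if_quadratic_le_zero[OF main] z_def by simp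
  show "(transpose V ** X ** V) $ j $ j \<le> (transpose V ** X ** V) $ i $ i"
    using main[of 0 1] by (simp add: z_def)
qed

section \<open>Independence of the choice of eigenbasis\<close>

text \<open>The weights are a function of the eigenvalue, so
  \<open>V ** diag_matrix f ** transpose V\<close> is that function applied to \<open>A\<close> and
  does not depend on the eigenbasis. The weighted trace is the trace of its product with
  \<open>X\<close>.\<close>

lemma weighted_trace_eigenbases_cong:
  fixes A X U V :: "real^'n^'n"
  assumes A: "transpose A = A" and U: "U \<in> eigenbases A l" and V: "V \<in> eigenbases A l"
    and f: "\<And>i j. l i = l j \<Longrightarrow> f i = f j"
  shows "weighted_trace f X U = weighted_trace f X V"
proof -
  define R where "R = transpose V ** U"
  have oU: "U ** transpose U = mat 1" and oV: "V ** transpose V = mat 1" "transpose V ** V = mat 1"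
    using U V by (auto simp: eigenbases_def orthogonal_matrix_def)
  \<comment> \<open>Eigenvectors of a symmetric matrix for different eigenvalues are orthogonal, so
    the transition matrix is block diagonal and commutes with weights constant on each
    block.\<close>
  have "R $ i $ j = 0" if "l i \<noteq> l j" for i j
  proof -
    have "l j * R $ i $ j = column i V \<bullet> (A *v column j U)"
      using U by (simp add: R_def transpose_mult_entry eigenbases_iff_columns)
    also have "\<dots> = column j U \<bullet> (A *v column i V)"
      by (rule symmetric_form[OF A])
    also have "\<dots> = l i * R $ i $ j"
      using V by (simp add: R_def transpose_mult_entry eigenbases_iff_columns inner_commute)
    finally show ?thesis using that by simp
  qed
  then have R: "R ** diag_matrix f = diag_matrix f ** R"
    unfolding vec_eq_iff diag_matrix_mult_entry mult_diag_matrix_entry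
    using f by (metis mult.commute mult_zero_left mult_zero_right)
  have VR: "V ** R = U"
    by (simp add: R_def matrix_mul_assoc oV)
  have "U ** diag_matrix f ** transpose U = V ** (R ** diag_matrix f) ** transpose U"
    by (simp add: VR matrix_mul_assoc)
  also have "\<dots> = V ** diag_matrix f ** transpose V ** (U ** transpose U)"
    unfolding R by (simp add: R_def matrix_mul_assoc)
  finally have eq: "U ** diag_matrix f ** transpose U = V ** diag_matrix f ** transpose V"
    by (simp add: oU)
  have "weighted_trace f X W = trace (W ** diag_matrix f ** transpose W ** X)" for W
    unfolding weighted_trace_def trace_diag_matrix_mult[symmetric]
    by (metis matrix_mul_assoc trace_mul_sym)
  then show ?thesis by (simp add: eq)
qed

section \<open>Uniqueness of the decreasing spectrum\<close>

text \<open>A product of linear factors determines the multiset of its roots, and a multiset has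
  only one monotone enumeration along the index order.\<close>

lemma decreasing_eq_if_char_poly_eq:
  fixes l m :: "'n::{finite,linorder} \<Rightarrow> real"
  assumes "antimono l" "antimono m"
    and eq: "\<And>t. (\<Prod>i\<in>UNIV. t - l i) = (\<Prod>i\<in>UNIV. t - m i)"
  shows "l = m"
proof -
  define xs where "xs = sorted_list_of_set (UNIV :: 'n set)"
  have proots: "proots (\<Prod>i\<in>UNIV. [:- h i, 1:]) = mset (map h xs)" for h :: "'n \<Rightarrow> real"
  proof -
    have "proots (\<Prod>i\<in>UNIV. [:- h i, 1:]) = (\<Sum>i\<in>UNIV. {#h i#})"
      by (subst proots_prod) simp_all
    also have "\<dots> = image_mset h (mset_set UNIV)"
      by (metis finite sum_unfold_sum_mset multiset.map_comp comp_def sum_mset_singleton_mset)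
    also have "\<dots> = mset (map h xs)"
      unfolding xs_def mset_map by (simp only: mset_sorted_list_of_multiset
          sorted_list_of_mset_set[symmetric])
    finally show ?thesis .
  qed
  have "(\<Prod>i\<in>UNIV. [:- l i, 1:]) = (\<Prod>i\<in>UNIV. [:- m i, 1:])"
    using eq by (subst poly_eq_poly_eq_iff[symmetric]) (auto simp: fun_eq_iff poly_prod)
  then have "mset (map l xs) = mset (map m xs)"
    by (metis proots)
  \<comment> \<open>\<open>sorted\<close> means nondecreasing, so the decreasing lists are negated
    first.\<close>
  then have mset: "mset (map uminus (map l xs)) = mset (map uminus (map m xs))"
    by (metis mset_map)
  have sorted: "sorted (map uminus (map h xs))" if "antimono h" for h :: "'n \<Rightarrow> real"
    using that unfolding map_map sorted_map
    by (rule_tac sorted_wrt_mono_rel[of _ "(\<le>)"]) (auto simp: xs_def antimono_def)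
  have "map uminus (map l xs) = map uminus (map m xs)"
    using properties_for_sort[OF mset] sorted assms sorted_sort_id by metis
  then have "map l xs = map m xs"
    by simp
  then show ?thesis
    by (simp add: xs_def fun_eq_iff)
qed

lemma char_poly_conjugate_diag:
  fixes X V :: "real^'n^'n"
  assumes "orthogonal_matrix V" and "transpose V ** X ** V = diag_matrix z"
  shows "det (mat t - X) = (\<Prod>i\<in>UNIV. t - z i)"
proof -
  have V: "transpose V ** V = mat 1" "V ** transpose V = mat 1"
    using assms(1) by (auto simp: orthogonal_matrix_def)
  have "diag_matrix (\<lambda>i. t - z i) = mat t - diag_matrix z"
    by (simp add: vec_eq_iff diag_matrix_def mat_def)
  also have "mat t = transpose V ** mat t ** V"
    by (metis V(1) mat_mult_commute matrix_mul_assoc matrix_mul_rid)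
  finally have "diag_matrix (\<lambda>i. t - z i) = transpose V ** (mat t - X) ** V"
    by (simp add: assms(2)[symmetric] matrix_diff_ldistrib matrix_diff_rdistrib)
  moreover have "det (diag_matrix (\<lambda>i. t - z i)) = (\<Prod>i\<in>UNIV. t - z i)"
    by (subst det_diagonal) (auto simp: diag_matrix_def)
  moreover have "det (transpose V) * det V = 1"
    by (metis V(1) det_I det_mul)
  ultimately show ?thesis
    by (metis det_mul mult.assoc mult.commute mult.right_neutral)
qed

text \<open>Identifies a diagonal produced by an extremal argument with the prescribed listing: both
  decrease and have the same characteristic polynomial.\<close>

lemma diagonal_eq_decreasing_spectrum:
  fixes X :: "real^'n::{finite,linorder}^'n::{finite,linorder}"
  assumes "orthogonal_matrix V" and "transpose V ** X ** V = diag_matrix z"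
    and "antimono z" and "decreasing_spectrum X m"
  shows "z = m"
  using assms char_poly_conjugate_diag[OF assms(1,2)]
  by (intro decreasing_eq_if_char_poly_eq) (auto simp: decreasing_spectrum_def antimono_def)

section \<open>Diagonalisation by two successive maximisations\<close>

lemma orthogonal_eq_eigenbases_0:
  "orthogonal_matrix V \<longleftrightarrow> V \<in> eigenbases 0 (\<lambda>_. 0)" for V :: "real^'n^'n"
  by (simp add: eigenbases_def vec_eq_iff mult_diag_matrix_entry matrix_matrix_mult_def[of 0])

text \<open>Maximising a second weighted trace, with strictly decreasing weights, over the
  eigenbases of \<open>A\<close> leaves the \<open>f\<close>-trace unchanged. The new basis is thus
  extremal for both weights, and each pair of indices is handled by one of them.\<close>

lemma weighted_trace_maximizer_diagonalizable:
  fixes A X P :: "real^'n::{finite,linorder}^'n::{finite,linorder}"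
  assumes A: "transpose A = A" and X: "transpose X = X" and P: "P \<in> eigenbases A l"
    and f: "antimono f" "\<And>i j. f i = f j \<longleftrightarrow> l i = l j"
    and max: "\<And>W. orthogonal_matrix W \<Longrightarrow> weighted_trace f X W \<le> weighted_trace f X P"
  obtains V z where "V \<in> eigenbases A l" "transpose V ** X ** V = diag_matrix z" "antimono z"
proof -
  \<comment> \<open>Minus the number of predecessors: strictly decreasing, so it separates indices
    that \<open>f\<close> ties.\<close>
  define g :: "'n \<Rightarrow> real" where "g i = - real (card {..<i})" for i
  have g: "g j < g i" if "i < j" for i j
    using that by (auto simp: g_def intro!: psubset_card_mono)
  obtain V where V: "V \<in> eigenbases A l"
    and Vmax: "\<And>W. W \<in> eigenbases A l \<Longrightarrow> weighted_trace g X W \<le> weighted_trace g X V"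
    using P weighted_trace_attains_max[of A l g X] by blast
  have VP: "weighted_trace f X V = weighted_trace f X P"
    using weighted_trace_eigenbases_cong[OF A V P] f(2) by blast
  have V0: "V \<in> eigenbases 0 (\<lambda>_. 0)"
    using V by (simp add: orthogonal_eq_eigenbases_0[symmetric]) (simp add: eigenbases_def)
  have fmax: "\<And>W. W \<in> eigenbases 0 (\<lambda>_. 0) \<Longrightarrow> weighted_trace f X W \<le> weighted_trace f X V"
    using max by (simp add: VP orthogonal_eq_eigenbases_0[symmetric])
  define Z where "Z = transpose V ** X ** V"
  have less: "Z $ i $ j = 0 \<and> Z $ j $ j \<le> Z $ i $ i" if "i < j" for i j
  \<comment> \<open>Equal weights mean equal eigenvalues, so the rotation stays among eigenbases of
    \<open>A\<close> and maximality for \<open>g\<close> applies. Otherwise it may leave them, and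
    maximality for \<open>f\<close> over all orthogonal matrices is used.\<close>
  proof (cases "f i = f j")
    case True
    then show ?thesis
      using weighted_trace_max_critical[OF X V Vmax] f(2) g[OF that] by (simp add: Z_def)
  next
    case False
    then have "f j < f i"
      using antimonoD[OF f(1) less_imp_le[OF that]] by simp
    then show ?thesis
      using weighted_trace_max_critical[OF X V0 fmax] by (simp add: Z_def)
  qed
  have sym: "Z $ i $ j = Z $ j $ i" for i j
    unfolding Z_def conjugate_entry by (rule symmetric_form[OF X])
  have "Z $ i $ j = 0" if "i \<noteq> j" for i j
    using that less sym by (metis linorder_neqE)
  then have "Z = diag_matrix (\<lambda>i. Z $ i $ i)"
    by (simp add: vec_eq_iff diag_matrix_def)
  moreover have "antimono (\<lambda>i. Z $ i $ i)"
    using less by (intro antimonoI) (metis order_le_less order_refl)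
  ultimately show ?thesis
    using that V by (auto simp: Z_def)
qed

text \<open>The spectral theorem, from the trivial case \<open>A = 0\<close>, \<open>f = 0\<close>:
  every orthogonal matrix is then a maximiser, and the second maximisation alone diagonalises
  \<open>X\<close>.\<close>

lemma decreasing_eigenbasis_exists:
  fixes X :: "real^'n::{finite,linorder}^'n::{finite,linorder}"
  assumes X: "transpose X = X" and m: "decreasing_spectrum X m"
  obtains V where "V \<in> eigenbases X m"
proof -
  have I: "mat 1 \<in> eigenbases (0 :: real^'n::{finite,linorder}^'n::{finite,linorder}) (\<lambda>_. 0)"
    by (simp add: orthogonal_eq_eigenbases_0[symmetric] orthogonal_matrix_id)
  have "transpose 0 = (0 :: real^'n::{finite,linorder}^'n::{finite,linorder})"
    by (simp add: vec_eq_iff transpose_def)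
  moreover have "antimono (\<lambda>_::'n. 0::real)"
    by (simp add: antimono_def)
  moreover have "weighted_trace (\<lambda>_. 0) X W \<le> weighted_trace (\<lambda>_. 0) X (mat 1)" for W
    by (simp add: weighted_trace_def)
  ultimately obtain V :: "real^'n::{finite,linorder}^'n::{finite,linorder}" and z where "V \<in> eigenbases 0 (\<lambda>_. 0)"
    "transpose V ** X ** V = diag_matrix z" "antimono z"
    using weighted_trace_maximizer_diagonalizable[OF _ X I, of "\<lambda>_. 0"] by blast
  with m that show ?thesis
    using diagonal_eq_decreasing_spectrum orthogonal_eq_eigenbases_0 eigenbases_iff_conjugate
    by metis
qed

section \<open>The spectral bound for weighted traces and its equality case\<close>

lemma weighted_trace_diagonal:
  assumes "transpose V ** X ** V = diag_matrix m"
  shows "weighted_trace f X V = (\<Sum>k\<in>UNIV. f k * m k)"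
  by (simp add: weighted_trace_def assms diag_matrix_def)

text \<open>Von Neumann's trace inequality for symmetric matrices. A maximiser over the orthogonal
  group exists by compactness and can be traded, at the same value, for a basis diagonalising
  \<open>X\<close> in decreasing order.\<close>

lemma weighted_trace_le_spectrum:
  fixes X W :: "real^'n::{finite,linorder}^'n::{finite,linorder}"
  assumes X: "transpose X = X" and m: "decreasing_spectrum X m" and f: "antimono f"
    and W: "orthogonal_matrix W"
  shows "weighted_trace f X W \<le> (\<Sum>k\<in>UNIV. f k * m k)"
proof -
  obtain U where U: "orthogonal_matrix U"
    and max: "\<And>W. orthogonal_matrix W \<Longrightarrow> weighted_trace f X W \<le> weighted_trace f X U"
    using weighted_trace_attains_max[of 0 "\<lambda>_. 0" f X] W
    unfolding orthogonal_eq_eigenbases_0 by blast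
  \<comment> \<open>An auxiliary matrix with eigenbasis \<open>U\<close> and eigenvalues
    \<open>f\<close>, so that ties among weights and among eigenvalues coincide by
    construction.\<close>
  define A where "A = U ** diag_matrix f ** transpose U"
  have "transpose (diag_matrix f) = diag_matrix f"
    by (simp add: vec_eq_iff diag_matrix_def transpose_def)
  then have A: "transpose A = A"
    by (simp add: A_def matrix_transpose_mul matrix_mul_assoc)
  have UA: "U \<in> eigenbases A f"
    using U by (simp add: eigenbases_def A_def orthogonal_matrix_def flip: matrix_mul_assoc)
  obtain V z where V: "V \<in> eigenbases A f" "transpose V ** X ** V = diag_matrix z" "antimono z"
    using weighted_trace_maximizer_diagonalizable[OF A X UA f _ max] by blast
  then have "z = m"
    using diagonal_eq_decreasing_spectrum m by (auto simp: eigenbases_def)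
  then have "weighted_trace f X V = (\<Sum>k\<in>UNIV. f k * m k)"
    using V weighted_trace_diagonal by blast
  moreover have "weighted_trace f X U = weighted_trace f X V"
    using weighted_trace_eigenbases_cong[OF A UA V(1)] by simp
  ultimately show ?thesis
    using max[OF W] by simp
qed

text \<open>Attaining the bound makes \<open>P\<close> a maximiser over all orthogonal matrices, so
  it can be replaced by an eigenbasis of \<open>A\<close> that also diagonalises
  \<open>X\<close>.\<close>

lemma weighted_trace_eq_spectrum:
  fixes A X P :: "real^'n::{finite,linorder}^'n::{finite,linorder}"
  assumes A: "transpose A = A" and X: "transpose X = X" and P: "P \<in> eigenbases A l"
    and m: "decreasing_spectrum X m"
    and f: "antimono f" "\<And>i j. f i = f j \<longleftrightarrow> l i = l j"
    and eq: "weighted_trace f X P = (\<Sum>k\<in>UNIV. f k * m k)"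
  obtains V where "V \<in> eigenbases A l" "V \<in> eigenbases X m"
proof -
  obtain V z where V: "V \<in> eigenbases A l" "transpose V ** X ** V = diag_matrix z" "antimono z"
    using weighted_trace_maximizer_diagonalizable[OF A X P f]
      weighted_trace_le_spectrum[OF X m f(1)] eq by metis
  then have "z = m"
    using diagonal_eq_decreasing_spectrum m by (auto simp: eigenbases_def)
  with V that show ?thesis
    by (simp add: eigenbases_iff_conjugate)
qed

text \<open>Diagonal matrices commute, hence so do matrices diagonal in one orthonormal basis. The
  equality case thus becomes a search for a common eigenbasis.\<close>

lemma commute_matching_spectra_iff:
  fixes A B :: "real^'n^'n"
  shows "commute_matching_spectra A l B m \<longleftrightarrow> eigenbases A l \<inter> eigenbases B m \<noteq> {}"
proof -
  have "A ** B = B ** A" if "V \<in> eigenbases A l" "V \<in> eigenbases B m" for V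
  proof -
    have V: "orthogonal_matrix V" using that by (simp add: eigenbases_def)
    have "V ** diag_matrix p ** transpose V ** (V ** diag_matrix q ** transpose V)
        = V ** diag_matrix (\<lambda>i. p i * q i) ** transpose V" for p q
      using V unfolding orthogonal_matrix_def diag_matrix_mult[symmetric]
      by (metis matrix_mul_assoc matrix_mul_lid)
    then show ?thesis
      using that[THEN eigenbases_decomposition] by (simp add: mult.commute)
  qed
  then show ?thesis
    by (auto simp: commute_matching_spectra_def eigenbases_iff_conjugate)
qed

section \<open>The trace inequality for fixed matrices\<close>

lemma matrix_inv_diag_matrix:
  fixes d :: "'n::finite \<Rightarrow> real"
  assumes "\<And>i. d i \<noteq> 0"
  shows "matrix_inv (diag_matrix d) = diag_matrix (\<lambda>i. inverse (d i))"
  by (rule matrix_inv_eqI) (simp add: diag_matrix_mult assms mat_eq_diag_matrix)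

text \<open>Coercivity on a unit eigenvector gives the weak bound; equality would put that vector in
  the kernel of \<open>A - mat a\<close>.\<close>

lemma eigenvalue_gt_if_coercive:
  fixes A V :: "real^'n^'n"
  assumes V: "V \<in> eigenbases A l" and inv: "invertible (A - mat a)"
    and coercive: "\<And>\<xi>. a * (norm \<xi>)\<^sup>2 \<le> (A *v \<xi>) \<bullet> \<xi>"
  shows "a < l k"
proof -
  have c: "column k V \<bullet> column k V = 1" "A *v column k V = l k *\<^sub>R column k V"
    using V by (auto simp: eigenbases_iff_columns)
  have "a \<le> l k"
    using coercive[of "column k V"] c by (simp add: norm_eq_1[symmetric])
  moreover have "l k \<noteq> a"
  proof
    assume "l k = a"
    then have "(A - mat a) *v column k V = 0"
      using c by (simp add: matrix_vector_mult_diff_rdistrib mat_vector_mult)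
    then have "column k V = 0"
      using inv by (metis invertible_def matrix_vector_mul_assoc matrix_vector_mul_lid
          matrix_vector_mult_0_right)
    with c show False by simp
  qed
  ultimately show ?thesis by simp
qed

text \<open>Cyclicity of the trace merges the two outer inverses into one square, which is diagonal
  in the basis \<open>P\<close>. The scalar part of \<open>B - mat b\<close> is unchanged by
  conjugation and splits off.\<close>

lemma trace_inverse_sandwich:
  fixes A B P :: "real^'n^'n"
  assumes P: "P \<in> eigenbases A l" and l: "\<And>k. l k \<noteq> a"
  shows "trace (matrix_inv (A - mat a) ** (B - mat b) ** matrix_inv (A - mat a)) =
    weighted_trace (\<lambda>k. inverse (l k - a) ^ 2) B P - b * (\<Sum>k\<in>UNIV. inverse (l k - a) ^ 2)"
proof -
  \<comment> \<open>Functional calculus in the basis \<open>P\<close>: \<open>C\<close> respects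
    products, differences and constants, so inverting \<open>A - mat a\<close> amounts to inverting
    numbers.\<close>
  define C where "C d = P ** diag_matrix d ** transpose P" for d
  have o: "P ** transpose P = mat 1" "transpose P ** P = mat 1"
    using P by (auto simp: eigenbases_def orthogonal_matrix_def)
  have C_mult: "C p ** C q = C (\<lambda>i. p i * q i)" for p q
    unfolding C_def diag_matrix_mult[symmetric] using o
    by (metis matrix_mul_assoc matrix_mul_lid)
  have C_diff: "C p - C q = C (\<lambda>i. p i - q i)" for p q
  proof -
    have "diag_matrix (\<lambda>i. p i - q i) = diag_matrix p - diag_matrix q"
      by (simp add: vec_eq_iff diag_matrix_def)
    then show ?thesis
      by (simp add: C_def matrix_diff_ldistrib matrix_diff_rdistrib)
  qed
  have C_const: "C (\<lambda>_. t) = mat t" for t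
  proof -
    have "C (\<lambda>_. t) = P ** mat t ** transpose P"
      by (simp add: C_def mat_eq_diag_matrix[of t])
    then show ?thesis
      by (metis o(1) mat_mult_commute matrix_mul_assoc matrix_mul_rid)
  qed
  have "A - mat a = C (\<lambda>k. l k - a)"
    using eigenbases_decomposition[OF P] C_diff[of l "\<lambda>_. a"] by (simp add: C_const C_def)
  then have inv: "matrix_inv (A - mat a) = C (\<lambda>k. inverse (l k - a))"
    using l by (intro matrix_inv_eqI) (simp add: C_mult C_const)
  have "trace (matrix_inv (A - mat a) ** (B - mat b) ** matrix_inv (A - mat a)) =
      trace (C (\<lambda>k. inverse (l k - a) ^ 2) ** (B - mat b))"
    unfolding inv trace_mul_sym[of _ "C _"] matrix_mul_assoc C_mult power2_eq_square ..
  also have "\<dots> = weighted_trace (\<lambda>k. inverse (l k - a) ^ 2) (B - mat b) P"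
    unfolding C_def weighted_trace_def trace_diag_matrix_mult[symmetric]
    by (metis matrix_mul_assoc trace_mul_sym)
  also have "\<dots> = weighted_trace (\<lambda>k. inverse (l k - a) ^ 2) B P
      - b * (\<Sum>k\<in>UNIV. inverse (l k - a) ^ 2)"
  proof -
    have "transpose P ** mat b ** P = mat b"
      by (metis o(2) mat_mult_commute matrix_mul_assoc matrix_mul_rid)
    then have "transpose P ** (B - mat b) ** P = transpose P ** B ** P - mat b"
      by (simp add: matrix_diff_ldistrib matrix_diff_rdistrib)
    then show "weighted_trace (\<lambda>k. inverse (l k - a) ^ 2) (B - mat b) P =
        weighted_trace (\<lambda>k. inverse (l k - a) ^ 2) B P
        - b * (\<Sum>k\<in>UNIV. inverse (l k - a) ^ 2)"
      by (simp add: weighted_trace_def mat_def right_diff_distrib sum_subtractf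
          sum_distrib_left mult.commute)
  qed
  finally show ?thesis .
qed

text \<open>Both sides contain the same term \<open>b * sum d UNIV\<close>, so only the weighted
  trace of \<open>B\<close> and its value for the ordered spectra are compared.\<close>

lemma trace_inverse_sandwich_ge:
  fixes A B :: "real^'n::{finite,linorder}^'n::{finite,linorder}"
    and a b :: real
  assumes A: "transpose A = A" and B: "transpose B = B"
    and coercive: "\<And>\<xi>. a * (norm \<xi>)\<^sup>2 \<le> (A *v \<xi>) \<bullet> \<xi>"
    and inv: "invertible (A - mat a)"
    and l: "decreasing_spectrum A l" and m: "decreasing_spectrum B m"
  defines "lhs \<equiv> trace (matrix_inv (A - mat a) ** (B - mat b) ** matrix_inv (A - mat a))"
    and "rhs \<equiv> trace (matrix_inv (diag_matrix (\<lambda>i. l i - a)) ** diag_matrix (\<lambda>i. m i - b)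
      ** matrix_inv (diag_matrix (\<lambda>i. l i - a)))"
  shows "rhs \<le> lhs" and "lhs = rhs \<longleftrightarrow> commute_matching_spectra A l B m"
proof -
  obtain P where P: "P \<in> eigenbases A l"
    using decreasing_eigenbasis_exists[OF A l] .
  have gt: "a < l k" for k
    by (rule eigenvalue_gt_if_coercive[OF P inv coercive])
  have ne: "l k \<noteq> a" for k
    using gt[of k] by simp
  define d where "d = (\<lambda>k. inverse (l k - a) ^ 2)"
  have lhs: "lhs = weighted_trace d B V - b * sum d UNIV" if "V \<in> eigenbases A l" for V
    using trace_inverse_sandwich[OF that ne] by (simp add: lhs_def d_def)
  have "rhs = trace (diag_matrix (\<lambda>k. inverse (l k - a) * (m k - b) * inverse (l k - a)))"
    using ne by (simp add: rhs_def matrix_inv_diag_matrix diag_matrix_mult)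
  also have "\<dots> = (\<Sum>k\<in>UNIV. d k * m k) - b * sum d UNIV"
    by (simp add: trace_def diag_matrix_def d_def power2_eq_square algebra_simps
        sum_subtractf sum_distrib_left)
  finally have rhs: "rhs = (\<Sum>k\<in>UNIV. d k * m k) - b * sum d UNIV" .
  \<comment> \<open>The weights \<open>d\<close> increase along the index; negating them turns the
    wanted lower bound into the upper bound for decreasing weights.\<close>
  have neg: "weighted_trace (\<lambda>k. - d k) B V = - weighted_trace d B V" for V
    by (simp add: weighted_trace_def sum_negf)
  have anti: "antimono (\<lambda>k. - d k)"
  proof (rule antimonoI)
    fix i j :: 'n
    assume "i \<le> j"
    then have "l j \<le> l i"
      using l by (simp add: decreasing_spectrum_def)
    then show "- d j \<le> - d i"
      using gt[of i] gt[of j] unfolding d_def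
      by (simp add: power_mono le_imp_inverse_le)
  qed
  \<comment> \<open>All gaps \<open>l k - a\<close> are positive, so the inverse square is injective
    on them: weights tie exactly where eigenvalues do, as the equality case requires.\<close>
  have inj: "- d i = - d j \<longleftrightarrow> l i = l j" for i j
    using gt[of i] gt[of j] by (auto simp: d_def)
  show "rhs \<le> lhs"
    using weighted_trace_le_spectrum[OF B m anti, of P] P lhs[OF P] rhs
    by (simp add: neg sum_negf eigenbases_def)
  show "lhs = rhs \<longleftrightarrow> commute_matching_spectra A l B m"
    unfolding commute_matching_spectra_iff
  proof
    assume "lhs = rhs"
    then have "weighted_trace (\<lambda>k. - d k) B P = (\<Sum>k\<in>UNIV. - d k * m k)"
      using lhs[OF P] rhs by (simp add: neg sum_negf)
    from weighted_trace_eq_spectrum[OF A B P m anti inj this]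
    show "eigenbases A l \<inter> eigenbases B m \<noteq> {}"
      by blast
  next
    assume "eigenbases A l \<inter> eigenbases B m \<noteq> {}"
    then obtain V where V: "V \<in> eigenbases A l" "V \<in> eigenbases B m"
      by blast
    then show "lhs = rhs"
      using weighted_trace_diagonal[of V B m d] lhs rhs by (simp add: eigenbases_iff_conjugate)
  qed
qed

section \<open>Passage to almost every point\<close>

theorem lemma7p2:
  fixes \<Omega> :: "(real^'n::{finite,linorder}) set"
    and a\<^sub>1 a\<^sub>2 b\<^sub>1 b\<^sub>2 :: real
    and A B :: "real^'n::{finite,linorder} \<Rightarrow> real^'n::{finite,linorder}^'n::{finite,linorder}"
    and lam mu :: "real^'n::{finite,linorder} \<Rightarrow> 'n \<Rightarrow> real"
  assumes "open \<Omega>" and "bounded \<Omega>"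
    and "0 < a\<^sub>1" and "a\<^sub>1 < a\<^sub>2" and "0 < b\<^sub>1" and "b\<^sub>1 < b\<^sub>2"
    and "A \<in> matrix_class a\<^sub>1 a\<^sub>2 \<Omega>"
    and "B \<in> matrix_class b\<^sub>1 (b\<^sub>2 * (a\<^sub>2 / a\<^sub>1)) \<Omega>"
    and "AE x in lebesgue_on \<Omega>. invertible (A x - mat a\<^sub>1)"
    and "AE x in lebesgue_on \<Omega>. decreasing_spectrum (A x) (lam x)"
    and "AE x in lebesgue_on \<Omega>. decreasing_spectrum (B x) (mu x)"
  shows "AE x in lebesgue_on \<Omega>.
    (let D_lam = diag_matrix (\<lambda>i. lam x i - a\<^sub>1);
         D_mu = diag_matrix (\<lambda>i. mu x i - b\<^sub>1);
         lhs = trace (matrix_inv (A x - mat a\<^sub>1) ** (B x - mat b\<^sub>1) ** matrix_inv (A x - mat a\<^sub>1));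
         rhs = trace (matrix_inv D_lam ** D_mu ** matrix_inv D_lam)
     in lhs \<ge> rhs \<and> (lhs = rhs \<longleftrightarrow> commute_matching_spectra (A x) (lam x) (B x) (mu x)))"
proof -
  \<comment> \<open>The quantifier over \<open>\<xi>\<close> stays inside, so one null set serves
    all vectors and the result for fixed matrices applies at each remaining
    \<open>x\<close>.\<close>
  have "AE x in lebesgue_on \<Omega>. transpose (A x) = A x \<and>
      (\<forall>\<xi>. (A x *v \<xi>) \<bullet> \<xi> \<ge> a\<^sub>1 * (norm \<xi>)\<^sup>2)"
    using assms(7) unfolding matrix_class_def by auto
  moreover have "AE x in lebesgue_on \<Omega>. transpose (B x) = B x"
    using assms(8) unfolding matrix_class_def by auto
  ultimately show ?thesis
    using assms(9,10,11) unfolding Let_def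
  proof eventually_elim
    case (elim x)
    then show ?case
      using trace_inverse_sandwich_ge[of "A x" "B x" a\<^sub>1 "lam x" "mu x" b\<^sub>1] by blast
  qed
qed

end
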